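(* For every integer $k\ge 3$, there exist infinitely many pairwise non-isomorphic $k$-graphs that are minimal asymmetric.
   Context: A $k$-graph is a pair $(X,\mathscr{M})$ with $X$ a finite set and $\mathscr{M}\subseteq\binom{X}{k}$. An automorphism is a bijection $\phi:X\to X$ with $\{\phi(M):M\in\mathscr{M}\}=\mathscr{M}$. A $k$-graph is asymmetric if its only automorphism is the identity, and symmetric otherwise. For $X'\subseteq X$, the induced sub-$k$-graph on $X'$ is $(X',\{M\in\mathscr{M}: M\subseteq X'\})$; it is non-trivial if $1<|X'|<|X|$. A $k$-graph is minimal asymmetric if it is asymmetric and every non-trivial induced sub-$k$-graph of it is symmetric. *)

theory Defs
  imports Main
begin

type_synonym 'a hgraph = "'a set \<times> 'a set set"

definition k_graph :: "nat \<Rightarrow> 'a hgraph \<Rightarrow> bool" where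
  "k_graph k G \<longleftrightarrow> finite (fst G) \<and> (\<forall>M\<in>snd G. M \<subseteq> fst G \<and> card M = k)"

definition hgraph_iso :: "('a \<Rightarrow> 'b) \<Rightarrow> 'a hgraph \<Rightarrow> 'b hgraph \<Rightarrow> bool" where
  "hgraph_iso f G H \<longleftrightarrow> bij_betw f (fst G) (fst H) \<and> {f ` M | M. M \<in> snd G} = snd H"

definition isomorphic :: "'a hgraph \<Rightarrow> 'b hgraph \<Rightarrow> bool" where
  "isomorphic G H \<longleftrightarrow> (\<exists>f. hgraph_iso f G H)"

definition automorphism :: "('a \<Rightarrow> 'a) \<Rightarrow> 'a hgraph \<Rightarrow> bool" where
  "automorphism f G \<longleftrightarrow> hgraph_iso f G G"

(* Automorphisms are total functions here, relevant only on the vertex set;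
   being the identity is therefore required on the vertex set only. *)
definition asymmetric :: "'a hgraph \<Rightarrow> bool" where
  "asymmetric G \<longleftrightarrow> (\<forall>f. automorphism f G \<longrightarrow> (\<forall>x\<in>fst G. f x = x))"

definition symmetric :: "'a hgraph \<Rightarrow> bool" where
  "symmetric G \<longleftrightarrow> \<not> asymmetric G"

definition induced_sub :: "'a hgraph \<Rightarrow> 'a set \<Rightarrow> 'a hgraph" where
  "induced_sub G X' = (X', {M \<in> snd G. M \<subseteq> X'})"

definition minimal_asymmetric :: "'a hgraph \<Rightarrow> bool" where
  "minimal_asymmetric G \<longleftrightarrow> asymmetric G \<and>
     (\<forall>X'. X' \<subseteq> fst G \<and> 1 < card X' \<and> card X' < card (fst G) \<longrightarrow> symmetric (induced_sub G X'))"

end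

theory Submission
  imports Defs "HOL-Combinatorics.Transposition"
begin

text \<open>
  It suffices to find, for arbitrarily large \<open>L\<close>, an asymmetric \<open>k\<close>-graph all of whose asymmetric
  induced sub-\<open>k\<close>-graphs on more than one vertex have at least \<open>L\<close> vertices: a smallest such
  sub-\<open>k\<close>-graph is then minimal asymmetric.

  Take a path of edges \<open>E\<^sub>0, \<dots>, E\<^sub>3\<^sub>L\<close>, where \<open>E\<^sub>i\<close> and \<open>E\<^sub>i\<^sub>+\<^sub>1\<close> share the vertex \<open>c\<^sub>i\<^sub>+\<^sub>1\<close>, together with a
  set \<open>W\<close> of \<open>k - 2\<close> further vertices. The edges at the three marked positions \<open>0\<close>, \<open>L\<close>, \<open>3L\<close> are
  completed by all of \<open>W\<close>; every other edge is completed by all but one element of \<open>W\<close> and a private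
  vertex \<open>p\<^sub>i\<close>. In an induced sub-\<open>k\<close>-graph, two vertices lying in the same edges can be swapped. Hence
  in an asymmetric one, a maximal run of surviving edges cannot end at an unmarked position \<open>i\<close>, where
  \<open>p\<^sub>i\<close> and an end vertex of the run lie in \<open>E\<^sub>i\<close> only; nor can it consist of a single edge. So a run
  joins two marked positions and is long. An automorphism of the whole preserves \<open>W\<close> (the
  vertices of degree at least three), the path and the marked positions, whose gaps \<open>L\<close> and \<open>2L\<close> rule
  out the reversal of the path.
\<close>

section \<open>Symmetry of hypergraphs\<close>

lemma twins_symmetric:
  assumes "x \<in> fst G" "y \<in> fst G" "x \<noteq> y"
    and "\<And>M. M \<in> snd G \<Longrightarrow> x \<in> M \<longleftrightarrow> y \<in> M"
  shows "symmetric G"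
proof -
  let ?t = "transpose x y"
  have im: "?t ` M = M" if "M \<in> snd G" for M
    using assms(4)[OF that] by (rule transpose_image_eq)
  have "bij_betw ?t (fst G) (fst G)"
    using assms(1,2) by (simp add: bij_betw_transpose_iff)
  moreover have "{?t ` M |M. M \<in> snd G} = snd G"
  proof -
    have "(`) ?t ` snd G = id ` snd G"
      by (rule image_cong) (simp_all add: im)
    then show ?thesis
      by (simp add: setcompr_eq_image)
  qed
  ultimately have "automorphism ?t G"
    unfolding automorphism_def hgraph_iso_def by blast
  moreover have "?t x \<noteq> x"
    using assms(3) by simp
  ultimately show ?thesis
    using assms(1) unfolding symmetric_def asymmetric_def by blast
qed

lemma isomorphic_card_eq: "isomorphic G H \<Longrightarrow> card (fst G) = card (fst H)"
  unfolding isomorphic_def hgraph_iso_def using bij_betw_same_card by blast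

lemma automorphism_degree:
  assumes aut: "automorphism f G" and sub: "\<And>M. M \<in> snd G \<Longrightarrow> M \<subseteq> fst G"
    and x: "x \<in> fst G"
  shows "card {M \<in> snd G. f x \<in> M} = card {M \<in> snd G. x \<in> M}"
proof -
  have bij: "bij_betw f (fst G) (fst G)" and im: "(`) f ` snd G = snd G"
    using aut unfolding automorphism_def hgraph_iso_def by (simp_all add: setcompr_eq_image)
  have inj: "inj_on f (fst G)"
    using bij by (rule bij_betw_imp_inj_on)
  have mem: "f x \<in> f ` M \<longleftrightarrow> x \<in> M" if "M \<in> snd G" for M
    using inj_on_image_mem_iff[OF inj x sub[OF that]] .
  have "(`) f ` {M \<in> snd G. x \<in> M} = {M \<in> snd G. f x \<in> M}"
  proof
    show "(`) f ` {M \<in> snd G. x \<in> M} \<subseteq> {M \<in> snd G. f x \<in> M}"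
      using im by auto
    show "{M \<in> snd G. f x \<in> M} \<subseteq> (`) f ` {M \<in> snd G. x \<in> M}"
    proof
      fix M assume "M \<in> {M \<in> snd G. f x \<in> M}"
      then have M: "M \<in> snd G" "f x \<in> M"
        by auto
      then obtain M' where "M' \<in> snd G" "M = f ` M'"
        using im by blast
      then show "M \<in> (`) f ` {M \<in> snd G. x \<in> M}"
        using M mem by auto
    qed
  qed
  moreover have "inj_on ((`) f) {M \<in> snd G. x \<in> M}"
    using inj_on_image_Pow[OF inj] sub by (auto intro: inj_on_subset)
  ultimately show ?thesis
    by (metis card_image)
qed

lemma fst_induced_sub [simp]: "fst (induced_sub G Y) = Y"
  by (simp add: induced_sub_def)

lemma snd_induced_sub [simp]: "snd (induced_sub G Y) = {M \<in> snd G. M \<subseteq> Y}"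
  by (simp add: induced_sub_def)

lemma induced_sub_induced_sub:
  "Z \<subseteq> Y \<Longrightarrow> induced_sub (induced_sub G Y) Z = induced_sub G Z"
  by (auto simp: induced_sub_def)

lemma k_graph_induced_sub:
  "k_graph k G \<Longrightarrow> Y \<subseteq> fst G \<Longrightarrow> k_graph k (induced_sub G Y)"
  unfolding k_graph_def by (auto intro: finite_subset)

lemma ex_minimal_asymmetric_induced_sub:
  assumes "k_graph k G" "asymmetric G" "1 < card (fst G)"
  obtains Y where "Y \<subseteq> fst G" "1 < card Y" "minimal_asymmetric (induced_sub G Y)"
proof -
  define P where "P Y \<longleftrightarrow> Y \<subseteq> fst G \<and> 1 < card Y \<and> asymmetric (induced_sub G Y)" for Y
  have "induced_sub G (fst G) = G"
    using assms(1) unfolding k_graph_def induced_sub_def by (auto intro: prod_eqI)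
  then have "P (fst G)"
    using assms unfolding P_def by simp
  then obtain Y where Y: "P Y" and min: "\<And>Z. P Z \<Longrightarrow> card Y \<le> card Z"
    by (metis ex_has_least_nat)
  have "symmetric (induced_sub (induced_sub G Y) Z)"
    if "Z \<subseteq> Y" "1 < card Z" "card Z < card Y" for Z
    using that Y min[of Z] unfolding P_def symmetric_def
    by (auto simp: induced_sub_induced_sub)
  then show ?thesis
    using that Y unfolding P_def minimal_asymmetric_def by auto
qed

section \<open>Rigidity of marked paths\<close>

text \<open>The value at \<open>i\<close> is within one of \<open>s (i - 1) = i - 1\<close>, and
  injectivity excludes all smaller positions, which are already taken, so only \<open>i\<close> is
  left.\<close>

lemma path_map_id:
  fixes s :: "nat \<Rightarrow> nat"
  assumes inj: "inj_on s {..N}"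
    and adj: "\<And>i. i < N \<Longrightarrow> s (Suc i) \<le> Suc (s i) \<and> s i \<le> Suc (s (Suc i))"
    and "s 0 = 0" "i \<le> N"
  shows "s i = i"
  using \<open>i \<le> N\<close>
proof (induction i rule: less_induct)
  case (less i)
  show ?case
  proof (cases i)
    case 0
    then show ?thesis using \<open>s 0 = 0\<close> by simp
  next
    case (Suc j)
    have sj: "s j = j"
      using less Suc by simp
    have ne: "s i \<noteq> l" if "l < i" for l
      using inj_onD[OF inj, of i l] less.IH[of l] less.prems that by auto
    have "s i \<noteq> j" "j \<noteq> 0 \<Longrightarrow> s i \<noteq> j - 1"
      using ne[of j] ne[of "j - 1"] Suc by auto
    then show ?thesis
      using adj[of j] sj Suc less.prems by (cases j) auto
  qed
qed

text \<open>The two neighbours of \<open>m\<close> have distinct images adjacent to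
  \<open>s m\<close>, so \<open>s m\<close> is no end of the path and must be \<open>m\<close>. Then
  \<open>s 0\<close> is an end; if it were \<open>N\<close>, then \<open>s\<close> would be the
  reversal, which moves \<open>m\<close> because \<open>2 * m \<noteq> N\<close>.\<close>

lemma marked_path_map_id:
  fixes s :: "nat \<Rightarrow> nat"
  assumes inj: "inj_on s {..N}" and le: "\<And>i. i \<le> N \<Longrightarrow> s i \<le> N"
    and adj: "\<And>i. i < N \<Longrightarrow> s (Suc i) \<le> Suc (s i) \<and> s i \<le> Suc (s (Suc i))"
    and m: "0 < m" "m < N" "2 * m \<noteq> N"
    and marks: "s 0 \<in> {0, m, N}" "s m \<in> {0, m, N}"
    and "i \<le> N"
  shows "s i = i"
proof -
  obtain l where l: "m = Suc l"
    using m by (cases m) auto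
  have ne: "s l \<noteq> s m" "s (Suc m) \<noteq> s m" "s l \<noteq> s (Suc m)" "s 0 \<noteq> s m"
    using inj m l by (auto simp: inj_on_eq_iff)
  have "s m = m"
    using marks(2) ne adj[of l] adj[of m] le[of l] le[of "Suc m"] m l by auto
  with marks(1) ne have "s 0 = 0 \<or> s 0 = N"
    by auto
  then show ?thesis
  proof
    assume "s 0 = 0"
    then show ?thesis
      using path_map_id[OF inj adj _ \<open>i \<le> N\<close>] by blast
  next
    assume "s 0 = N"
    \<comment> \<open>Composing with the reversal gives a map that starts at 0.\<close>
    have "inj_on (\<lambda>i. N - s i) {..N}"
      using inj le unfolding inj_on_def by (metis atMost_iff diff_diff_cancel)
    moreover have "N - s (Suc i) \<le> Suc (N - s i) \<and> N - s i \<le> Suc (N - s (Suc i))"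
      if "i < N" for i
      using adj[OF that] by linarith
    ultimately have "N - s m = m"
      using path_map_id[of "\<lambda>i. N - s i" N m] \<open>s 0 = N\<close> m by simp
    then show ?thesis
      using \<open>s m = m\<close> m by simp
  qed
qed

text \<open>Here \<open>l\<close> stands for the edge joining path vertices \<open>l\<close> and
  \<open>Suc l\<close>. A common edge forces two vertices to be consecutive; with at least two
  edges, the next edge on one side contains only one of them.\<close>

lemma path_vertex_determined:
  fixes i j n :: nat
  assumes "\<And>l. l \<le> n \<Longrightarrow> (i = l \<or> i = Suc l) \<longleftrightarrow> (j = l \<or> j = Suc l)"
    and "i \<le> Suc n" "j \<le> Suc n" "0 < n"
  shows "i = j"
proof (rule ccontr)
  assume "i \<noteq> j"
  define a b where "a = min i j" and "b = max i j"
  have ab: "a < b" "b \<le> Suc n"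
    and mem: "\<And>l. l \<le> n \<Longrightarrow> (a = l \<or> a = Suc l) \<longleftrightarrow> (b = l \<or> b = Suc l)"
    using assms \<open>i \<noteq> j\<close> by (auto simp: a_def b_def min_def max_def)
  have "b = Suc a"
    using mem[of a] ab by auto
  show False
  proof (cases a)
    case 0
    then show False
      using mem[of b] \<open>b = Suc a\<close> \<open>0 < n\<close> by simp
  next
    case (Suc l)
    then show False
      using mem[of l] ab \<open>b = Suc a\<close> by simp
  qed
qed

section \<open>The marked path hypergraph\<close>

text \<open>The three kinds of vertices are encoded by residues modulo 3.\<close>

definition c :: "nat \<Rightarrow> nat" where "c i = 3 * i"
definition p :: "nat \<Rightarrow> nat" where "p i = 3 * i + 1"
definition w :: "nat \<Rightarrow> nat" where "w i = 3 * i + 2"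

lemma vertex_simps [simp]:
  "c i = c j \<longleftrightarrow> i = j" "p i = p j \<longleftrightarrow> i = j" "w i = w j \<longleftrightarrow> i = j"
  "c i \<noteq> p j" "p i \<noteq> c j" "c i \<noteq> w j" "w i \<noteq> c j" "p i \<noteq> w j" "w i \<noteq> p j"
  unfolding c_def p_def w_def by presburger+

text \<open>Edges will have \<open>r + 2\<close> vertices. The bound \<open>r \<le> L\<close> keeps
  all positions strictly between 0 and \<open>r\<close> unmarked.\<close>

locale marked_path =
  fixes L r :: nat
  assumes r_pos: "1 \<le> r" and r_le: "r \<le> L"
begin

definition marked :: "nat \<Rightarrow> bool" where
  "marked i \<longleftrightarrow> i \<in> {0, L, 3 * L}"

definition W :: "nat set" where
  "W = w ` {..<r}"

text \<open>The index \<open>min i (r - 1)\<close> of the element missing from \<open>E\<^sub>i\<close> takes every value except 0 at an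
  unmarked position, so that an automorphism fixing all edges fixes \<open>W\<close> pointwise.\<close>

definition E :: "nat \<Rightarrow> nat set" where
  "E i = {c i, c (Suc i)} \<union> (if marked i then W else insert (p i) (W - {w (min i (r - 1))}))"

definition V :: "nat set" where
  "V = c ` {..Suc (3 * L)} \<union> p ` {i. i \<le> 3 * L \<and> \<not> marked i} \<union> W"

definition G :: "nat hgraph" where
  "G = (V, E ` {..3 * L})"

lemma L_pos: "1 \<le> L"
  using r_pos r_le by simp

lemma c_in_E [simp]: "c j \<in> E i \<longleftrightarrow> j = i \<or> j = Suc i"
  by (auto simp: E_def W_def)

lemma p_in_E [simp]: "p j \<in> E i \<longleftrightarrow> j = i \<and> \<not> marked i"
  by (auto simp: E_def W_def)

lemma w_in_E: "w j \<in> E i \<longleftrightarrow> j < r \<and> (marked i \<or> j \<noteq> min i (r - 1))"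
  by (auto simp: E_def W_def)

lemma notin_W [simp]: "c i \<notin> W" "p i \<notin> W"
  by (auto simp: W_def)

lemma w_in_W [simp]: "w i \<in> W \<longleftrightarrow> i < r"
  by (auto simp: W_def)

lemma E_eq_iff [simp]: "E i = E j \<longleftrightarrow> i = j"
proof
  assume "E i = E j"
  then have "c i \<in> E j" "c (Suc i) \<in> E j"
    by (metis c_in_E)+
  then show "i = j" by auto
qed simp

text \<open>Since \<open>W\<close> will turn out to be invariant, this makes markedness invariant
  under automorphisms.\<close>

lemma marked_iff: "marked i \<longleftrightarrow> W \<subseteq> E i"
proof
  assume "W \<subseteq> E i"
  moreover have "w (min i (r - 1)) \<in> W"
    using r_pos by auto
  ultimately show "marked i"
    using w_in_E by blast
qed (auto simp: E_def)

lemma card_E: "card (E i) = r + 2"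
proof (cases "marked i")
  case True
  have "E i = insert (c i) (insert (c (Suc i)) W)"
    using True by (auto simp: E_def)
  moreover have "card W = r" "finite W"
    by (auto simp: W_def card_image inj_on_def)
  ultimately show ?thesis
    by simp
next
  case False
  have eq: "E i = insert (c i) (insert (c (Suc i)) (insert (p i) (W - {w (min i (r - 1))})))"
    using False by (auto simp: E_def)
  have "card W = r" "finite W"
    by (auto simp: W_def card_image inj_on_def)
  moreover have "w (min i (r - 1)) \<in> W"
    using r_pos by auto
  ultimately have "card (W - {w (min i (r - 1))}) = r - 1" "finite W"
    by auto
  then show ?thesis
    using r_pos unfolding eq by simp
qed

lemma E_subset_V: "i \<le> 3 * L \<Longrightarrow> E i \<subseteq> V"
  by (auto simp: E_def V_def split: if_splits)

lemma finite_V: "finite V"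
  by (auto simp: V_def W_def)

lemma k_graph_G: "k_graph (r + 2) G"
  using E_subset_V finite_V card_E by (auto simp: k_graph_def G_def)

section \<open>Invariants of automorphisms and asymmetry\<close>

lemma V_cases:
  assumes "x \<in> V"
  obtains (c) i where "x = c i" "i \<le> Suc (3 * L)"
  | (p) i where "x = p i" "i \<le> 3 * L" "\<not> marked i"
  | (w) i where "x = w i" "i < r"
  using assms by (auto simp: V_def W_def)

lemma in_W_iff_degree:
  assumes "x \<in> V"
  shows "x \<in> W \<longleftrightarrow> 3 \<le> card {M \<in> snd G. x \<in> M}"
  using assms
proof (cases rule: V_cases)
  case (c i)
  \<comment> \<open>For \<open>i = 0\<close> the subtraction truncates and both listed edges are
    \<open>E 0\<close>.\<close>
  have "{M \<in> snd G. x \<in> M} \<subseteq> {E (i - 1), E i}"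
    using c by (auto simp: G_def)
  then have "card {M \<in> snd G. x \<in> M} \<le> card {E (i - 1), E i}"
    by (intro card_mono) auto
  also have "\<dots> \<le> 2"
    by (simp add: card_insert_if)
  finally show ?thesis
    using c by simp
next
  case (p i)
  have "{M \<in> snd G. x \<in> M} \<subseteq> {E i}"
    using p by (auto simp: G_def)
  then have "card {M \<in> snd G. x \<in> M} \<le> card {E i}"
    by (intro card_mono) auto
  then show ?thesis
    using p by simp
next
  case (w i)
  have "{E 0, E L, E (3 * L)} \<subseteq> {M \<in> snd G. x \<in> M}"
    using w by (auto simp: G_def w_in_E marked_def)
  then have "card {E 0, E L, E (3 * L)} \<le> card {M \<in> snd G. x \<in> M}"
    by (intro card_mono) (auto simp: G_def)
  moreover have "card {E 0, E L, E (3 * L)} = 3"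
    using L_pos by (simp add: card_insert_if)
  ultimately show ?thesis
    using w by simp
qed

text \<open>Edges far apart can still meet inside \<open>W\<close>, so only common vertices outside
  \<open>W\<close> detect closeness on the path.\<close>

lemma adjacent_iff: "(\<exists>x \<in> E i \<inter> E j. x \<notin> W) \<longleftrightarrow> i \<le> Suc j \<and> j \<le> Suc i"
proof
  assume "\<exists>x \<in> E i \<inter> E j. x \<notin> W"
  then show "i \<le> Suc j \<and> j \<le> Suc i"
    by (auto simp: E_def split: if_splits)
next
  assume "i \<le> Suc j \<and> j \<le> Suc i"
  then have "c (max i j) \<in> E i \<inter> E j"
    by (auto simp: max_def)
  then show "\<exists>x \<in> E i \<inter> E j. x \<notin> W"
    using notin_W by blast
qed

lemma asymmetric_G: "asymmetric G"
  unfolding asymmetric_def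
proof (intro allI impI)
  fix f assume aut: "automorphism f G"
  then have bij: "bij_betw f V V" and im: "(`) f ` E ` {..3 * L} = E ` {..3 * L}"
    unfolding automorphism_def hgraph_iso_def G_def by (simp_all add: setcompr_eq_image)
  have fV: "f x \<in> V" if "x \<in> V" for x
    using bij that by (rule bij_betwE[rule_format])
  have inj: "inj_on f V"
    using bij by (rule bij_betw_imp_inj_on)
  have fW: "f x \<in> W \<longleftrightarrow> x \<in> W" if "x \<in> V" for x
  proof -
    have "M \<subseteq> fst G" if "M \<in> snd G" for M
      using k_graph_G that unfolding k_graph_def by blast
    then have "card {M \<in> snd G. f x \<in> M} = card {M \<in> snd G. x \<in> M}"
      using automorphism_degree[OF aut] that by (simp add: G_def)
    then show ?thesis
      using in_W_iff_degree[OF that] in_W_iff_degree[OF fV[OF that]] by simp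
  qed
  have "W \<subseteq> V"
    by (auto simp: V_def)
  have "f ` W = W"
  proof (rule endo_inj_surj)
    show "finite W"
      by (simp add: W_def)
    show "f ` W \<subseteq> W"
      using fW \<open>W \<subseteq> V\<close> by blast
    show "inj_on f W"
      using inj \<open>W \<subseteq> V\<close> by (rule inj_on_subset)
  qed
  have "\<exists>j. j \<le> 3 * L \<and> f ` E i = E j" if "i \<le> 3 * L" for i
  proof -
    have "f ` E i \<in> (`) f ` E ` {..3 * L}"
      using that by auto
    then show ?thesis
      unfolding im by auto
  qed
  \<comment> \<open>\<open>s\<close> is the action of \<open>f\<close> on edge positions; it will be
    shown to satisfy the hypotheses of \<open>marked_path_map_id\<close>.\<close>
  then obtain s where s: "\<And>i. i \<le> 3 * L \<Longrightarrow> s i \<le> 3 * L" "\<And>i. i \<le> 3 * L \<Longrightarrow> f ` E i = E (s i)"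
    by metis
  have inj_s: "inj_on s {..3 * L}"
  proof (rule inj_onI)
    fix i j assume ij: "i \<in> {..3 * L}" "j \<in> {..3 * L}" "s i = s j"
    then have "f ` E i = f ` E j"
      using s by auto
    then have "E i = E j"
      using inj_on_image_eq_iff[OF inj] E_subset_V ij by auto
    then show "i = j" by simp
  qed
  have marked_s: "marked (s i)" if "i \<le> 3 * L" "marked i" for i
    using image_mono[of W "E i" f] that s(2)[OF that(1)] \<open>f ` W = W\<close> by (simp add: marked_iff)
  have adj: "s (Suc i) \<le> Suc (s i) \<and> s i \<le> Suc (s (Suc i))" if "i < 3 * L" for i
  proof -
    obtain x where x: "x \<in> E (Suc i)" "x \<in> E i" "x \<notin> W"
      using adjacent_iff[of "Suc i" i] by auto
    then have "f x \<in> E (s (Suc i)) \<inter> E (s i)" "f x \<notin> W"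
      using s(2)[of i] s(2)[of "Suc i"] fW[of x] E_subset_V[of i] that by auto
    then show ?thesis
      using adjacent_iff by blast
  qed
  have "s i = i" if "i \<le> 3 * L" for i
  proof (rule marked_path_map_id[OF inj_s s(1) adj])
    show "0 < L" "L < 3 * L" "2 * L \<noteq> 3 * L"
      using L_pos by simp_all
    show "s 0 \<in> {0, L, 3 * L}" "s L \<in> {0, L, 3 * L}"
      using marked_s[of 0] marked_s[of L] by (simp_all add: marked_def)
  qed (use that in simp_all)
  then have fE: "f x \<in> E i \<longleftrightarrow> x \<in> E i" if "i \<le> 3 * L" "x \<in> V" for i x
    using s(2)[OF that(1)] inj_on_image_mem_iff[OF inj that(2) E_subset_V[OF that(1)]] that by simp
  \<comment> \<open>Now that every edge is preserved, a vertex outside \<open>W\<close> is recovered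
    from the edges containing it.\<close>
  have fix_outside: "f x = x" if x: "x \<in> V" "x \<notin> W" for x
  proof -
    have same: "f x \<in> V" "f x \<notin> W" "\<And>i. i \<le> 3 * L \<Longrightarrow> f x \<in> E i \<longleftrightarrow> x \<in> E i"
      using x fV fW fE by auto
    show ?thesis
      using x(1)
    proof (cases rule: V_cases)
      case (c i)
      show ?thesis
        using same(1)
      proof (cases rule: V_cases)
        case c': (c j)
        have "j = l \<or> j = Suc l \<longleftrightarrow> i = l \<or> i = Suc l" if "l \<le> 3 * L" for l
          using same(3)[OF that] c(1) c'(1) by simp
        then have "i = j"
          using path_vertex_determined[of "3 * L" j i] c(2) c'(2) L_pos by simp
        then show ?thesis
          using c c' by simp
      next
        \<comment> \<open>An unmarked \<open>j\<close> is inside the path, so both neighbouring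
          edges exist. A private vertex avoids them, whereas a path vertex of \<open>E j\<close>
          lies in one of them.\<close>
        case (p j)
        then have "0 < j" "j < 3 * L"
          by (auto simp: marked_def le_less)
        then have "x \<in> E j" "x \<notin> E (j - 1)" "x \<notin> E (Suc j)"
          using same(3)[of j] same(3)[of "j - 1"] same(3)[of "Suc j"] p by (cases j; simp)+
        then have False
          using c \<open>0 < j\<close> by auto
        then show ?thesis ..
      next
        case (w j)
        then show ?thesis
          using same(2) by simp
      qed
    next
      case (p i)
      then have "0 < i" "i < 3 * L"
        by (auto simp: marked_def le_less)
      then have "f x \<in> E i" "f x \<notin> E (i - 1)" "f x \<notin> E (Suc i)"
        using same(3)[of i] same(3)[of "i - 1"] same(3)[of "Suc i"] p by (cases i; simp)+
      then have "f x \<noteq> c j" for j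
        using \<open>0 < i\<close> by auto
      from same(1) show ?thesis
      proof (cases rule: V_cases)
        case (p j)
        then show ?thesis
          using \<open>f x \<in> E i\<close> \<open>x = p i\<close> by simp
      qed (use \<open>\<And>j. f x \<noteq> c j\<close> same(2) in auto)
    next
      case (w i)
      then show ?thesis using x by simp
    qed
  qed
  \<comment> \<open>\<open>w i\<close> is the only element of \<open>W\<close> missing from
    \<open>E i\<close>. The remaining \<open>w 0\<close> is then fixed by injectivity.\<close>
  have fix_W: "f (w i) = w i" if i: "0 < i" "i < r" for i
  proof -
    have um: "\<not> marked i" "min i (r - 1) = i" "i \<le> 3 * L"
      using i r_le by (auto simp: marked_def)
    have "w i \<in> V"
      using \<open>W \<subseteq> V\<close> i by auto
    then have "f (w i) \<in> W" "f (w i) \<notin> E i"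
      using fW[of "w i"] fE[of i "w i"] um i w_in_E[of i i] by auto
    then show ?thesis
      using um by (auto simp: W_def w_in_E)
  qed
  have "f (w 0) = w 0"
  proof -
    have w0: "w 0 \<in> W"
      using r_pos by simp
    then obtain j where j: "f (w 0) = w j" "j < r"
      using \<open>f ` W = W\<close> by (auto simp: W_def)
    show ?thesis
    proof (cases "j = 0")
      case False
      then have "f (w j) = f (w 0)"
        using fix_W j by simp
      then show ?thesis
        using inj_onD[OF inj_on_subset[OF inj \<open>W \<subseteq> V\<close>], of "w j" "w 0"] w0 j False by auto
    qed (use j in simp)
  qed
  then have "f x = x" if "x \<in> W" for x
    using that fix_W unfolding W_def by (metis gr0I imageE lessThan_iff)
  then show "\<forall>x\<in>fst G. f x = x"
    using fix_outside by (auto simp: G_def)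
qed

section \<open>Size of asymmetric induced sub-hypergraphs\<close>

lemma asymmetric_induced_sub_large:
  assumes asym: "asymmetric (induced_sub G Y)" and "Y \<subseteq> V" "1 < card Y"
  shows "L \<le> card Y"
proof -
  define S where "S = {i. i \<le> 3 * L \<and> E i \<subseteq> Y}"
  have edges: "{M \<in> snd G. M \<subseteq> Y} = E ` S"
    by (auto simp: S_def G_def)
  have no_twins: "\<exists>i\<in>S. (x \<in> E i) \<noteq> (y \<in> E i)" if "x \<in> Y" "y \<in> Y" "x \<noteq> y" for x y
    using twins_symmetric[of x "induced_sub G Y" y] asym that unfolding symmetric_def
    by (auto simp: edges)
  have "finite S"
    by (simp add: S_def)
  have "S \<noteq> {}"
  proof
    assume "S = {}"
    moreover obtain x y where "x \<in> Y" "y \<in> Y" "x \<noteq> y"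
      using \<open>1 < card Y\<close>
        by (metis One_nat_def card_le_Suc0_iff_eq card.infinite not_less zero_less_one less_le_not_le)
    ultimately show False
      using no_twins by blast
  qed
  define b where "b = Max S"
  have b: "b \<in> S" "Suc b \<notin> S"
    using \<open>finite S\<close> \<open>S \<noteq> {}\<close> by (auto simp: b_def) (metis Max_ge Suc_n_not_le_n)
  \<comment> \<open>The positions from \<open>a\<close> to \<open>b\<close> form the last maximal
    run of surviving edges.\<close>
  define a where "a = (LEAST a. {a..b} \<subseteq> S)"
  have run: "{a..b} \<subseteq> S"
    unfolding a_def by (rule LeastI[of _ b]) (use b in simp)
  have least: "a \<le> d" if "{d..b} \<subseteq> S" for d
    unfolding a_def using that by (rule Least_le)
  have "a \<le> b"
    using least[of b] b by simp
  then have "a \<in> S"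
    using run by auto
  have pred: "d \<notin> S" if "Suc d = a" for d
  proof
    assume "d \<in> S"
    have "{d..b} = insert d {a..b}"
      using that \<open>a \<le> b\<close> by auto
    then have "{d..b} \<subseteq> S"
      using run \<open>d \<in> S\<close> by simp
    then show False
      using least[of d] that by simp
  qed
  have inY: "x \<in> Y" if "i \<in> S" "x \<in> E i" for i x
    using that by (auto simp: S_def)
  \<comment> \<open>As \<open>Suc b \<notin> S\<close>, the vertices \<open>c (Suc b)\<close> and
    \<open>p b\<close> would both lie in \<open>E b\<close> only. The start \<open>a\<close> is
    treated symmetrically.\<close>
  have "marked b"
  proof (rule ccontr)
    assume "\<not> marked b"
    then obtain i where "i \<in> S" "(c (Suc b) \<in> E i) \<noteq> (p b \<in> E i)"
      using no_twins[of "c (Suc b)" "p b"] inY[OF b(1)] by auto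
    then show False
      using b \<open>\<not> marked b\<close> by auto
  qed
  have "marked a"
  proof (rule ccontr)
    assume "\<not> marked a"
    then obtain i where "i \<in> S" "(c a \<in> E i) \<noteq> (p a \<in> E i)"
      using no_twins[of "c a" "p a"] inY[OF \<open>a \<in> S\<close>] by auto
    then show False
      using pred \<open>\<not> marked a\<close> by auto
  qed
  have "a \<noteq> b"
  proof
    assume "a = b"
    then obtain i where "i \<in> S" "(c a \<in> E i) \<noteq> (c (Suc b) \<in> E i)"
      using no_twins[of "c a" "c (Suc b)"] inY[OF b(1)] by auto
    then show False
      using pred b \<open>a = b\<close> by auto
  qed
  then have "L \<le> b - a"
    using \<open>marked a\<close> \<open>marked b\<close> \<open>a \<le> b\<close> by (auto simp: marked_def)
  also have "\<dots> \<le> card (c ` {a..b})"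
    by (simp add: card_image inj_on_def)
  also have "\<dots> \<le> card Y"
  proof (rule card_mono)
    show "finite Y"
      using \<open>Y \<subseteq> V\<close> finite_V by (rule finite_subset)
    show "c ` {a..b} \<subseteq> Y"
      using run inY by fastforce
  qed
  finally show ?thesis .
qed

end

section \<open>Infinitely many isomorphism classes\<close>

lemma ex_large_minimal_asymmetric:
  assumes "3 \<le> k"
  shows "\<exists>H :: nat hgraph. k_graph k H \<and> minimal_asymmetric H \<and> n \<le> card (fst H)"
proof -
  \<comment> \<open>The length \<open>n + k\<close> bounds both the required size \<open>n\<close>
    and \<open>k - 2\<close>.\<close>
  interpret marked_path "n + k" "k - 2"
    by standard (use assms in auto)
  have "k - 2 + 2 = k"
    using assms by simp
  then have k: "k_graph k G"
    using k_graph_G by metis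
  have "fst G = V"
    by (simp add: G_def)
  have "E 0 \<subseteq> V"
    by (rule E_subset_V) simp
  then have "1 < card V"
    using card_mono[OF finite_V, of "E 0"] card_E[of 0] by simp
  then obtain Y where Y: "Y \<subseteq> V" "1 < card Y" "minimal_asymmetric (induced_sub G Y)"
    using ex_minimal_asymmetric_induced_sub[OF k asymmetric_G] \<open>fst G = V\<close> by metis
  then have "n + k \<le> card Y"
    using asymmetric_induced_sub_large unfolding minimal_asymmetric_def by blast
  then show ?thesis
    using k_graph_induced_sub[OF k, of Y] Y \<open>fst G = V\<close> by (intro exI[of _ "induced_sub G Y"]) simp
qed

theorem theorem3:
  fixes k :: nat
  assumes "k \<ge> 3"
  shows "\<exists>\<G> :: nat hgraph set. infinite \<G> \<and>
           (\<forall>G\<in>\<G>. k_graph k G \<and> minimal_asymmetric G) \<and>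
           pairwise (\<lambda>G H. \<not> isomorphic G H) \<G>"
proof -
  define A :: "nat hgraph set" where "A = {H. k_graph k H \<and> minimal_asymmetric H}"
  define size where "size H = card (fst H)" for H :: "nat hgraph"
  \<comment> \<open>\<open>B\<close> picks one hypergraph of each size occurring in
    \<open>A\<close>; different sizes rule out isomorphism, and the sizes are unbounded.\<close>
  obtain B where B: "B \<subseteq> A" "inj_on size B" "size ` A = size ` B"
    by (metis subset_image_inj subset_refl)
  have "\<exists>H\<in>A. n < size H" for n
    using ex_large_minimal_asymmetric[OF assms, of "Suc n"]
    unfolding A_def size_def Suc_le_eq by blast
  then have "infinite (size ` A)"
    unfolding finite_nat_set_iff_bounded_le by (metis image_eqI not_le)
  then have "infinite B"
    using B(3) by auto
  moreover have "pairwise (\<lambda>G H. \<not> isomorphic G H) B"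
    using B(2) isomorphic_card_eq unfolding pairwise_def inj_on_def size_def by blast
  ultimately show ?thesis
    using B(1) unfolding A_def by blast
qed

end
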